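(* Let $m\ge1$ and let $k_1,\ldots,k_m$, $n_1,\ldots,n_m$ be integers with $n_i \geq k_i \geq 0$ for all $i \in [m]$. Let $M$ be the complement of a $(k_1, \ldots, k_m ; n_1, \ldots, n_m)$ circulant block diagonal matrix. Suppose that some $j \in [m]$ satisfies $n_j=k_j+\gcd(n_j,k_j)$ and $\gcd(n_j,k_j) > 1$. Then $\mathrm{rank}_{\mathrm{bin}}(M) \geq \mathrm{rank}_{\mathbb{R}}(M)+1$.
   Context: For integers $n \ge k \ge 0$, $D_{n,k}$ denotes the $n\times n$ circulant $0,1$ matrix whose first row consists of $n-k$ ones followed by $k$ zeros, each subsequent row being the cyclic shift of the previous row by one position to the right. For integers $n_i \ge k_i \ge 0$ ($i\in[m]$), a matrix is called $(k_1,\ldots,k_m;n_1,\ldots,n_m)$ circulant block diagonal if it is a block matrix with $m$ diagonal blocks whose $i$th diagonal block is $D_{n_i,n_i-k_i}$ and all of whose other entries are zero. The complement of a $0,1$ matrix is obtained by swapping zeros and ones. The binary rank $\mathrm{rank}_{\mathrm{bin}}(A)$ is the smallest number of combinatorial rectangles (all-one submatrices indexed by a set of rows times a set of columns) that partition the ones of $A$. $\mathrm{rank}_{\mathbb{R}}$ is the rank over the reals. Here $\gcd(n,0)=n$.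
   Formalization: The index j is additionally required to satisfy k_j > 0; for k_j = 0 the condition n_j = k_j + gcd(n_j,k_j) is automatic and the claim fails, e.g. m = 1, k_1 = 0, n_1 = 2 gives the all-ones 2×2 matrix, with both ranks equal to 1. *)

theory Defs
  imports
    "Jordan_Normal_Form.DL_Rank"
    "HOL-Library.Disjoint_Sets"
begin

text \<open>Rows and columns are indexed from 0, so the entry in row \<open>i\<close> and column \<open>j\<close> of the circulant
  matrix is the entry of the first row in position \<open>(j - i) mod n\<close>.\<close>

definition circulant_D :: "nat \<Rightarrow> nat \<Rightarrow> real mat" where
  "circulant_D n k = mat n n (\<lambda>(i, j). if (j + (n - i)) mod n < n - k then 1 else 0)"

definition circulant_block_diagonal :: "nat \<Rightarrow> (nat \<Rightarrow> nat) \<Rightarrow> (nat \<Rightarrow> nat) \<Rightarrow> real mat" where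
  "circulant_block_diagonal m k n =
     diag_block_mat (map (\<lambda>i. circulant_D (n i) (n i - k i)) [1..<m + 1])"

definition complement_mat :: "real mat \<Rightarrow> real mat" where
  "complement_mat A = map_mat (\<lambda>x. 1 - x) A"

definition ones :: "real mat \<Rightarrow> (nat \<times> nat) set" where
  "ones A = {(i, j). i < dim_row A \<and> j < dim_col A \<and> A $$ (i, j) = 1}"

definition comb_rectangle :: "real mat \<Rightarrow> (nat \<times> nat) set \<Rightarrow> bool" where
  "comb_rectangle A R \<longleftrightarrow> (\<exists>X Y. X \<subseteq> {..<dim_row A} \<and> Y \<subseteq> {..<dim_col A} \<and> R = X \<times> Y \<and>
     (\<forall>i\<in>X. \<forall>j\<in>Y. A $$ (i, j) = 1))"

definition binary_rank :: "real mat \<Rightarrow> nat" where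
  "binary_rank A = (LEAST d. \<exists>P. finite P \<and> card P = d \<and>
     (\<forall>R\<in>P. comb_rectangle A R) \<and> partition_on (ones A) P)"

definition real_rank :: "real mat \<Rightarrow> nat" where
  "real_rank A = vec_space.rank (dim_row A) A"

text \<open>If \<open>k j = 0\<close>, then \<open>n j = k j + gcd (n j) (k j)\<close> holds trivially, and the complement of the
  \<open>j\<close>-th block is all ones. The binary rank need not exceed the real rank in that case, already
  for a single block.\<close>

lemma binary_rank_eq_real_rank_zero_block:
  defines "M \<equiv> complement_mat (circulant_block_diagonal 1 (\<lambda>_. 0) (\<lambda>_. 2))"
  shows "binary_rank M = 1" and "real_rank M = 1"
proof -
  have M: "M = mat 2 2 (\<lambda>_. 1)"
    unfolding M_def complement_mat_def circulant_block_diagonal_def circulant_D_def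
    by (auto intro!: eq_matI)
  have ones: "ones M = {..<2} \<times> {..<2}" by (auto simp: M ones_def)
  show "binary_rank M = 1"
    unfolding binary_rank_def
  proof (rule Least_equality)
    have "comb_rectangle M ({..<2} \<times> {..<2})"
      unfolding comb_rectangle_def
      by (rule exI[of _ "{..<2}"], rule exI[of _ "{..<2}"]) (auto simp: M)
    moreover have "partition_on (ones M) {{..<2} \<times> {..<2}}"
      unfolding ones by (rule partition_on_space) (auto simp: lessThan_empty_iff)
    ultimately show "\<exists>P. finite P \<and> card P = 1 \<and>
        (\<forall>R\<in>P. comb_rectangle M R) \<and> partition_on (ones M) P"
      by (intro exI[of _ "{{..<2} \<times> {..<2}}"]) auto
  next
    fix d
    assume "\<exists>P. finite P \<and> card P = d \<and> (\<forall>R\<in>P. comb_rectangle M R) \<and> partition_on (ones M) P"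
    then obtain P where P: "finite P" "card P = d" "\<Union>P = ones M"
      by (auto simp: partition_on_def)
    have "(0, 0) \<in> ones M" by (simp add: ones)
    with P show "1 \<le> d" by (cases "P = {}") (auto simp: Suc_le_eq card_gt_0_iff)
  qed
  interpret vec_space "TYPE(real)" 2 .
  define v :: "real vec" where "v = vec 2 (\<lambda>_. 1)"
  have cols: "set (cols M) = {v}"
    by (auto simp: M v_def cols_def set_conv_nth intro!: exI[of _ 0])
  have v: "v \<in> carrier_vec 2" by (simp add: v_def)
  have v0: "v \<noteq> 0\<^sub>v 2"
  proof
    assume "v = 0\<^sub>v 2"
    then have "v $ 0 = 0\<^sub>v 2 $ 0" by (rule arg_cong)
    then show False by (simp add: v_def)
  qed
  have "lin_indpt {v}"
  proof
    assume "lin_dep {v}"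
    then obtain a where a: "lincomb a {v} = 0\<^sub>v 2" "a v \<noteq> 0"
      using finite_lin_dep[of "{v}"] v by auto
    have "lincomb a {v} = a v \<cdot>\<^sub>v v" using v by (simp add: lincomb_def)
    with a have "(a v \<cdot>\<^sub>v v) $ 0 = 0\<^sub>v 2 $ 0" by simp
    then show False using a(2) by (simp add: v_def)
  qed
  moreover have "M \<in> carrier_mat 2 2" by (simp add: M)
  ultimately have "rank M = card {v}"
    by (intro rank_card_indpt[of _ 2]) (auto simp: cols maximal_def)
  then show "real_rank M = 1" by (simp add: real_rank_def M)
qed

end

theory Submission
  imports Defs
begin

text \<open>Write \<open>d = gcd (n j) (k j)\<close> and \<open>n j = d * (r + 1)\<close> with \<open>r \<ge> 1\<close>. In the \<open>j\<close>-th block of \<open>M\<close>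
  every row consists of \<open>d\<close> cyclically consecutive ones. Hence for each residue \<open>i\<close> modulo \<open>d\<close>, the
  rows \<open>i + q * d\<close> of that block have the same sum, and likewise for the columns.
  If the number of rectangles were equal to the real rank, then the indicator vectors of the row
  sets (and of the column sets) would be linearly independent, so every rectangle would satisfy the
  linear relations between the rows and the columns of \<open>M\<close>: its row set meets all residue classes of
  rows of the block equally often, and so does its column set. A rectangle through a one of the
  block then contains rows and columns of both classes 0 and 1, and no four ones of the block
  are positioned in this way.\<close>

section \<open>Rank of matrices written as sums of products\<close>

lemma rank_le_card_sum_products:
  fixes A :: "'a :: field mat"
  assumes "finite T" and "A \<in> carrier_mat nr nc"
    and "\<And>i c. i < nr \<Longrightarrow> c < nc \<Longrightarrow> A $$ (i, c) = (\<Sum>t\<in>T. a t i * b t c)"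
  shows "vec_space.rank nr A \<le> card T"
  using assms
proof (induction T arbitrary: A rule: finite_induct)
  case empty
  then have "A = 0\<^sub>m nr nc" by (intro eq_matI) auto
  then show ?case by (simp add: vec_space.rank_0I)
next
  case (insert s T)
  let ?B = "mat nr nc (\<lambda>(i, c). a s i * b s c)"
  let ?C = "mat nr nc (\<lambda>(i, c). \<Sum>t\<in>T. a t i * b t c)"
  have "A = ?B + ?C"
    using insert by (intro eq_matI) auto
  then have "vec_space.rank nr A \<le> vec_space.rank nr ?B + vec_space.rank nr ?C"
    using vec_space.rank_subadditive[of ?B nr nc ?C] by simp
  moreover have "vec_space.rank nr ?B \<le> 1"
    by (rule vec_space.rank_le_1_product_entries[of _ _ nc "a s" "b s"]) auto
  moreover have "vec_space.rank nr ?C \<le> card T"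
    by (rule insert.IH) auto
  ultimately have "vec_space.rank nr A \<le> 1 + card T" by linarith
  with insert.hyps show ?case by simp
qed

text \<open>As \<open>v s\<close> is nonzero, the relation can be solved for \<open>b s c\<close>;
  substituting this moves the term of \<open>s\<close> into the coefficients of the other
  \<open>b t c\<close>.\<close>

lemma sum_products_drop_dependent:
  fixes a :: "'t \<Rightarrow> 'i \<Rightarrow> 'a :: field"
  assumes "finite T" and "s \<in> T" and "v s \<noteq> 0"
    and "(\<Sum>t\<in>T. v t * b t c) = 0"
  shows "(\<Sum>t\<in>T. a t i * b t c) = (\<Sum>t\<in>T - {s}. (a t i - a s i * v t / v s) * b t c)"
proof -
  have "v s * b s c + (\<Sum>t\<in>T - {s}. v t * b t c) = 0"
    using assms by (simp add: sum.remove)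
  then have "b s c = - (\<Sum>t\<in>T - {s}. v t * b t c) / v s"
    using assms(3) by (simp add: field_simps add_eq_0_iff)
  then have "a s i * b s c = - (\<Sum>t\<in>T - {s}. a s i * v t / v s * b t c)"
    by (simp add: sum_distrib_left sum_divide_distrib mult.assoc)
  then show ?thesis
    using assms(1,2) by (simp add: sum.remove[of T s] algebra_simps sum_subtractf)
qed

lemma rank_less_card_sum_products:
  fixes A :: "'a :: field mat"
  assumes "finite T" and "A \<in> carrier_mat nr nc"
    and A: "\<And>i c. i < nr \<Longrightarrow> c < nc \<Longrightarrow> A $$ (i, c) = (\<Sum>t\<in>T. a t i * b t c)"
    and "s \<in> T" and "v s \<noteq> 0"
    and dep: "(\<forall>c<nc. (\<Sum>t\<in>T. v t * b t c) = 0) \<or> (\<forall>i<nr. (\<Sum>t\<in>T. v t * a t i) = 0)"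
  shows "vec_space.rank nr A < card T"
proof -
  have "\<exists>a' b'. \<forall>i<nr. \<forall>c<nc. A $$ (i, c) = (\<Sum>t\<in>T - {s}. a' t i * b' t c)"
    using dep
  proof
    assume "\<forall>c<nc. (\<Sum>t\<in>T. v t * b t c) = 0"
    then show ?thesis
      using sum_products_drop_dependent[of T s v b _ a] assms(1,4,5) A
      by (intro exI[of _ "\<lambda>t i. a t i - a s i * v t / v s"] exI[of _ b]) auto
  next
    \<comment> \<open>The same elimination with the two factors exchanged.\<close>
    assume "\<forall>i<nr. (\<Sum>t\<in>T. v t * a t i) = 0"
    then show ?thesis
      using sum_products_drop_dependent[of T s v a _ b] assms(1,4,5) A
      by (intro exI[of _ a] exI[of _ "\<lambda>t c. b t c - b s c * v t / v s"])
        (auto simp: mult.commute)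
  qed
  then obtain a' b' where
    "\<And>i c. i < nr \<Longrightarrow> c < nc \<Longrightarrow> A $$ (i, c) = (\<Sum>t\<in>T - {s}. a' t i * b' t c)" by blast
  then have "vec_space.rank nr A \<le> card (T - {s})"
    using assms(1,2) by (intro rank_le_card_sum_products[of _ _ _ nc a' b']) auto
  also have "\<dots> < card T" using assms(1,4) by (rule card_Diff1_less)
  finally show ?thesis .
qed

section \<open>Rectangle partitions as factorizations\<close>

definition rectangle_partition :: "real mat \<Rightarrow> (nat \<times> nat) set set \<Rightarrow> bool" where
  "rectangle_partition A P \<longleftrightarrow>
     finite P \<and> (\<forall>R\<in>P. comb_rectangle A R) \<and> partition_on (ones A) P"

text \<open>The singletons of ones form a partition, so the \<open>LEAST\<close> ranges over a
  nonempty set.\<close>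

lemma binary_rank_attained: "\<exists>P. rectangle_partition A P \<and> card P = binary_rank A"
proof -
  have fin: "finite (ones A)"
    by (rule finite_subset[of _ "{..<dim_row A} \<times> {..<dim_col A}"]) (auto simp: ones_def)
  have "comb_rectangle A {x}" if "x \<in> ones A" for x
    using that unfolding comb_rectangle_def ones_def
    by (intro exI[of _ "{fst x}"] exI[of _ "{snd x}"]) auto
  moreover have "partition_on (ones A) ((\<lambda>x. {x}) ` ones A)"
    by (auto simp: partition_on_def disjoint_def)
  ultimately have "\<exists>d P. finite P \<and> card P = d \<and>
     (\<forall>R\<in>P. comb_rectangle A R) \<and> partition_on (ones A) P"
    using fin by (intro exI[of _ "card ((\<lambda>x. {x}) ` ones A)"] exI[of _ "(\<lambda>x. {x}) ` ones A"]) auto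
  from LeastI_ex[OF this] show ?thesis
    by (auto simp: rectangle_partition_def binary_rank_def)
qed

lemma rectangle_mem_iff:
  assumes "comb_rectangle A R"
  shows "(i, c) \<in> R \<longleftrightarrow> i \<in> fst ` R \<and> c \<in> snd ` R"
  using assms by (force simp: comb_rectangle_def)

text \<open>A one lies in exactly one rectangle and a zero in none. Each rectangle thus contributes
  one product of a row and a column indicator, the form that the rank bounds take.\<close>

lemma rectangle_partition_entry:
  assumes P: "rectangle_partition A P"
    and "i < dim_row A" "c < dim_col A" "A $$ (i, c) \<in> {0, 1}"
  shows "A $$ (i, c) = (\<Sum>R\<in>P. of_bool (i \<in> fst ` R) * of_bool (c \<in> snd ` R))"
proof -
  have "(\<Sum>R\<in>P. of_bool (i \<in> fst ` R) * of_bool (c \<in> snd ` R))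
      = (\<Sum>R\<in>P. of_bool ((i, c) \<in> R) :: real)"
    using P by (intro sum.cong) (auto simp: rectangle_partition_def rectangle_mem_iff)
  also have "\<dots> = A $$ (i, c)"
  proof (cases "(i, c) \<in> ones A")
    case True
    with P obtain R where R: "R \<in> P" "(i, c) \<in> R"
      by (auto simp: rectangle_partition_def partition_on_def)
    then have "S \<in> P \<Longrightarrow> (i, c) \<in> S \<longleftrightarrow> S = R" for S
      using P unfolding rectangle_partition_def partition_on_def disjoint_def
      by (metis disjoint_iff)
    then have "(\<Sum>R\<in>P. of_bool ((i, c) \<in> R) :: real) = (\<Sum>S\<in>P. of_bool (S = R))"
      by (intro sum.cong) auto
    also have "\<dots> = 1"
      using R P by (simp add: rectangle_partition_def of_bool_def)
    finally show ?thesis using True by (simp add: ones_def)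
  next
    case False
    then have "(i, c) \<notin> R" if "R \<in> P" for R
      using P that by (auto simp: rectangle_partition_def partition_on_def)
    then show ?thesis using False assms by (auto simp: ones_def)
  qed
  finally show ?thesis by simp
qed

text \<open>If a rectangle violated a linear relation between the rows, then its column indicator would be
  a combination of those of the other rectangles, and \<open>A\<close> would be a sum of fewer than \<open>card P\<close>
  matrices of rank one.\<close>

lemma rank_partition_row_relation:
  assumes P: "rectangle_partition A P"
    and bin: "\<And>i c. i < dim_row A \<Longrightarrow> c < dim_col A \<Longrightarrow> A $$ (i, c) \<in> {0, 1}"
    and rank: "card P \<le> real_rank A"
    and f: "\<And>q. q \<in> Q \<Longrightarrow> f q < dim_row A" and g: "\<And>q. q \<in> Q \<Longrightarrow> g q < dim_row A"
    and rel: "\<And>c. c < dim_col A \<Longrightarrow> (\<Sum>q\<in>Q. A $$ (f q, c)) = (\<Sum>q\<in>Q. A $$ (g q, c))"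
    and "R \<in> P"
  shows "(\<Sum>q\<in>Q. of_bool (f q \<in> fst ` R)) = (\<Sum>q\<in>Q. of_bool (g q \<in> fst ` R) :: real)"
proof (rule ccontr)
  let ?a = "\<lambda>R i. of_bool (i \<in> fst ` R) :: real"
  let ?b = "\<lambda>R c. of_bool (c \<in> snd ` R) :: real"
  \<comment> \<open>The amount by which \<open>R\<close> violates the relation. These numbers are
    the coefficients of a linear dependence between the column indicators.\<close>
  define v where "v R = (\<Sum>q\<in>Q. ?a R (f q)) - (\<Sum>q\<in>Q. ?a R (g q))" for R :: "(nat \<times> nat) set"
  assume "\<not> ?thesis"
  then have vR: "v R \<noteq> 0" by (simp add: v_def)
  note entry = rectangle_partition_entry[OF P _ _ bin]
  have split: "(\<Sum>R\<in>P. (\<Sum>q\<in>Q. ?a R (h q)) * ?b R c) = (\<Sum>q\<in>Q. A $$ (h q, c))"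
    if "c < dim_col A" and "\<And>q. q \<in> Q \<Longrightarrow> h q < dim_row A" for h c
  proof -
    have "(\<Sum>R\<in>P. (\<Sum>q\<in>Q. ?a R (h q)) * ?b R c) = (\<Sum>q\<in>Q. \<Sum>R\<in>P. ?a R (h q) * ?b R c)"
      unfolding sum_distrib_right by (rule sum.swap)
    also have "\<dots> = (\<Sum>q\<in>Q. A $$ (h q, c))"
      using that entry by (intro sum.cong) auto
    finally show ?thesis .
  qed
  have "(\<Sum>R\<in>P. v R * ?b R c) = 0" if "c < dim_col A" for c
    using split[OF that, of f] split[OF that, of g] f g rel[OF that]
    by (simp add: v_def left_diff_distrib sum_subtractf)
  then have "vec_space.rank (dim_row A) A < card P"
    using P entry \<open>R \<in> P\<close> vR
    by (intro rank_less_card_sum_products[of P A _ "dim_col A" ?a ?b R v])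
      (auto simp: rectangle_partition_def)
  with rank show False by (simp add: real_rank_def)
qed

text \<open>The transposed argument: a violated relation between columns makes the row indicators
  dependent.\<close>

lemma rank_partition_col_relation:
  assumes P: "rectangle_partition A P"
    and bin: "\<And>i c. i < dim_row A \<Longrightarrow> c < dim_col A \<Longrightarrow> A $$ (i, c) \<in> {0, 1}"
    and rank: "card P \<le> real_rank A"
    and f: "\<And>q. q \<in> Q \<Longrightarrow> f q < dim_col A" and g: "\<And>q. q \<in> Q \<Longrightarrow> g q < dim_col A"
    and rel: "\<And>i. i < dim_row A \<Longrightarrow> (\<Sum>q\<in>Q. A $$ (i, f q)) = (\<Sum>q\<in>Q. A $$ (i, g q))"
    and "R \<in> P"
  shows "(\<Sum>q\<in>Q. of_bool (f q \<in> snd ` R)) = (\<Sum>q\<in>Q. of_bool (g q \<in> snd ` R) :: real)"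
proof (rule ccontr)
  let ?a = "\<lambda>R i. of_bool (i \<in> fst ` R) :: real"
  let ?b = "\<lambda>R c. of_bool (c \<in> snd ` R) :: real"
  define v where "v R = (\<Sum>q\<in>Q. ?b R (f q)) - (\<Sum>q\<in>Q. ?b R (g q))" for R :: "(nat \<times> nat) set"
  assume "\<not> ?thesis"
  then have vR: "v R \<noteq> 0" by (simp add: v_def)
  note entry = rectangle_partition_entry[OF P _ _ bin]
  have split: "(\<Sum>R\<in>P. (\<Sum>q\<in>Q. ?b R (h q)) * ?a R i) = (\<Sum>q\<in>Q. A $$ (i, h q))"
    if "i < dim_row A" and "\<And>q. q \<in> Q \<Longrightarrow> h q < dim_col A" for h i
  proof -
    have "(\<Sum>R\<in>P. (\<Sum>q\<in>Q. ?b R (h q)) * ?a R i) = (\<Sum>q\<in>Q. \<Sum>R\<in>P. ?a R i * ?b R (h q))"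
      unfolding sum_distrib_right by (subst sum.swap) (simp add: mult.commute)
    also have "\<dots> = (\<Sum>q\<in>Q. A $$ (i, h q))"
      using that entry by (intro sum.cong) auto
    finally show ?thesis .
  qed
  have "(\<Sum>R\<in>P. v R * ?a R i) = 0" if "i < dim_row A" for i
    using split[OF that, of f] split[OF that, of g] f g rel[OF that]
    by (simp add: v_def left_diff_distrib sum_subtractf)
  then have "vec_space.rank (dim_row A) A < card P"
    using P entry \<open>R \<in> P\<close> vR
    by (intro rank_less_card_sum_products[of P A _ "dim_col A" ?a ?b R v])
      (auto simp: rectangle_partition_def)
  with rank show False by (simp add: real_rank_def)
qed

section \<open>Entries of the circulant block in base \<open>d\<close>\<close>

lemma mod_Suc_diff_eq_iff:
  fixes p q r :: nat
  assumes "p \<le> r" "q \<le> r"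
  shows "(p + r - q) mod Suc r = r \<longleftrightarrow> p = q"
proof (cases "q \<le> p")
  case True
  show ?thesis
  proof (cases "p = q")
    case False
    with True have "p + r - q = (p - q - 1) + Suc r" by simp
    then have "(p + r - q) mod Suc r = (p - q - 1) mod Suc r" by (metis mod_add_self2)
    then show ?thesis using assms False True by simp
  qed simp
qed (use assms in simp)

text \<open>The zeros of a row are the \<open>d\<close> columns cyclically just before the diagonal.
  This window contains each residue \<open>c\<close> modulo \<open>d\<close> once: in the row's own
  group of \<open>d\<close> columns if \<open>c < i\<close>, in the preceding group
  otherwise.\<close>

lemma circulant_D_entry:
  assumes "i < d" "c < d" "q \<le> r" "p \<le> r"
  shows "circulant_D (d * Suc r) d $$ (i + q * d, c + p * d) =
    of_bool (\<not> (if c < i then p = q else Suc p mod Suc r = q))"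
proof -
  let ?x = "c + p * d + (d * Suc r - (i + q * d))"
  have lt: "e + s * d < d * Suc r" if "e < d" "s \<le> r" for e s
  proof -
    have "e + s * d < Suc s * d" using that by simp
    also have "\<dots> \<le> Suc r * d" using that by (intro mult_le_mono1) simp
    finally show ?thesis by (simp add: mult.commute)
  qed
  obtain s where s: "r = q + s" using assms(3) le_Suc_ex by blast
  have x: "?x = c + (d - i) + d * (p + s)"
    using assms(1) by (simp add: s algebra_simps)
  have div: "?x div d = (if c < i then p + s else Suc (p + s))"
  proof (cases "c < i")
    case True
    then have "c + (d - i) < d" using assms(1) by simp
    with True show ?thesis unfolding x by simp
  next
    case False
    then have "?x = (c - i) + d * Suc (p + s)" and "c - i < d"
      unfolding x using assms(1,2) by simp_all
    then have "?x div d = Suc (p + s)" by (simp del: mult_Suc_right)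
    with False show ?thesis by simp
  qed
  have "?x mod (d * Suc r) = d * (?x div d mod Suc r) + ?x mod d" by (rule mod_mult2_eq)
  \<comment> \<open>The threshold \<open>d * r\<close> is a multiple of \<open>d\<close>, so the
    quotient by \<open>d\<close> alone decides whether the entry is a one.\<close>
  moreover have "d * e + w < d * r \<longleftrightarrow> e \<noteq> r" if "e \<le> r" "w < d" for e w
  proof (cases "e = r")
    case False
    with that have "d * Suc e \<le> d * r" by (intro mult_le_mono2) simp
    with that False show ?thesis by simp
  qed simp
  ultimately have "?x mod (d * Suc r) < d * r \<longleftrightarrow> ?x div d mod Suc r \<noteq> r"
    using assms(1) by (simp add: less_Suc_eq_le[symmetric])
  also have "\<dots> \<longleftrightarrow> \<not> (if c < i then p = q else Suc p mod Suc r = q)"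
  proof (cases "c < i")
    case True
    then show ?thesis
      unfolding div using mod_Suc_diff_eq_iff[OF assms(4,3)] by (simp add: s)
  next
    case False
    have "Suc (p + s) mod Suc r = r \<longleftrightarrow> Suc p mod Suc r = q"
    \<comment> \<open>For \<open>p = r\<close> the successor wraps around to 0 and exceeds the range
      of \<open>mod_Suc_diff_eq_iff\<close>.\<close>
    proof (cases "p = r")
      case True
      then have "Suc (p + s) mod Suc r = s mod Suc r"
        by (metis add_Suc mod_add_self1)
      with True show ?thesis by (auto simp: s)
    next
      case False
      then show ?thesis
        using mod_Suc_diff_eq_iff[of "Suc p" r q] assms(3,4) by (simp add: s)
    qed
    with False show ?thesis unfolding div by simp
  qed
  finally show ?thesis
    using assms lt by (auto simp: circulant_D_def)
qed

lemma sum_circulant_D_rows: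
  assumes "i < d" "c < d * Suc r"
  shows "(\<Sum>q\<le>r. circulant_D (d * Suc r) d $$ (i + q * d, c)) = r"
proof -
  \<comment> \<open>The index of the only row of class \<open>i\<close> with a zero in column
    \<open>c\<close>.\<close>
  define p where "p = (if c mod d < i then c div d else Suc (c div d) mod Suc r)"
  have c: "c div d \<le> r" "c mod d < d" "c = c mod d + c div d * d"
    using assms by (simp_all add: less_mult_imp_div_less less_Suc_eq_le[symmetric] mult.commute)
  have "(\<Sum>q\<le>r. circulant_D (d * Suc r) d $$ (i + q * d, c)) = (\<Sum>q\<le>r. 1 - of_bool (p = q))"
    using circulant_D_entry[OF assms(1) c(2) _ c(1)] c(3)
    by (intro sum.cong) (auto simp: p_def)
  also have "\<dots> = r"
    using c(1) by (auto simp: sum_subtractf of_bool_def p_def less_Suc_eq_le[symmetric])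
  finally show ?thesis .
qed

lemma sum_circulant_D_cols:
  assumes "c < d" "i < d * Suc r"
  shows "(\<Sum>p\<le>r. circulant_D (d * Suc r) d $$ (i, c + p * d)) = r"
proof -
  \<comment> \<open>The index of the only column of class \<open>c\<close> with a zero in row
    \<open>i\<close>; the last two cases invert the cyclic successor.\<close>
  define q where "q = (if c < i mod d then i div d else if i div d = 0 then r else i div d - 1)"
  have i: "i div d \<le> r" "i mod d < d" "i = i mod d + i div d * d"
    using assms by (simp_all add: less_mult_imp_div_less less_Suc_eq_le[symmetric] mult.commute)
  have succ: "Suc p mod Suc r = t \<longleftrightarrow> p = (if t = 0 then r else t - 1)" if "p \<le> r" "t \<le> r" for p t
    using that by (cases "p = r") auto
  have "(\<Sum>p\<le>r. circulant_D (d * Suc r) d $$ (i, c + p * d)) = (\<Sum>p\<le>r. 1 - of_bool (p = q))"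
    using circulant_D_entry[OF i(2) assms(1) i(1)] i(1,3) succ
    by (intro sum.cong) (auto simp: q_def)
  also have "\<dots> = r"
    using i(1) by (auto simp: sum_subtractf of_bool_def q_def less_Suc_eq_le[symmetric])
  finally show ?thesis .
qed

section \<open>Locating the block inside the large matrix\<close>

text \<open>Since the preceding blocks are square, \<open>B\<close> starts at the same offset
  \<open>s\<close> in rows and columns. The disjunction describes the cross formed by the rows and
  columns through \<open>B\<close>.\<close>

lemma diag_block_mat_entry:
  fixes B :: "'a :: zero mat"
  assumes "Ball (set As) square_mat"
    and "s = sum_list (map dim_row As)"
    and "i < dim_row (diag_block_mat (As @ B # Cs))" "c < dim_col (diag_block_mat (As @ B # Cs))"
    and "i \<in> {s..<s + dim_row B} \<or> c \<in> {s..<s + dim_col B}"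
  shows "diag_block_mat (As @ B # Cs) $$ (i, c) =
    (if i \<in> {s..<s + dim_row B} \<and> c \<in> {s..<s + dim_col B} then B $$ (i - s, c - s) else 0)"
proof -
  have "dim_row (diag_block_mat As) = s" "dim_col (diag_block_mat As) = s"
    using diag_block_mat_square[OF assms(1)] assms(2) by (simp_all add: dim_diag_block_mat)
  then show ?thesis
    using assms(3-) by (auto simp: diag_block_mat_append Let_def)
qed

lemma complement_circulant_block_diagonal_binary:
  assumes "M = complement_mat (circulant_block_diagonal m k n)"
    and "i < dim_row M" "c < dim_col M"
  shows "M $$ (i, c) \<in> {0, 1}"
proof -
  let ?D = "circulant_block_diagonal m k n"
  have "elements_mat (circulant_D a b) \<subseteq> {0, 1}" for a b
    by (auto simp: circulant_D_def elements_mat_def)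
  then have "elements_mat ?D \<subseteq> {0, 1}"
    using elements_diag_block_mat[of "map (\<lambda>i. circulant_D (n i) (n i - k i)) [1..<m + 1]"]
    unfolding circulant_block_diagonal_def set_map image_image
    by (elim order_trans) (simp add: UN_subset_iff)
  moreover have "?D $$ (i, c) \<in> elements_mat ?D"
    using assms by (intro elements_matI[of _ "dim_row ?D" "dim_col ?D"]) (auto simp: complement_mat_def)
  ultimately show ?thesis
    using assms by (auto simp: complement_mat_def)
qed

lemma complement_circulant_block_diagonal_entry:
  fixes k n :: "nat \<Rightarrow> nat"
  assumes "M = complement_mat (circulant_block_diagonal m k n)"
    and "j \<in> {1..m}"
  obtains s where "s + n j \<le> dim_row M" "s + n j \<le> dim_col M"
    "\<And>i c. i < dim_row M \<Longrightarrow> c < dim_col M \<Longrightarrow> i \<in> {s..<s + n j} \<or> c \<in> {s..<s + n j} \<Longrightarrow>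
       M $$ (i, c) = (if i \<in> {s..<s + n j} \<and> c \<in> {s..<s + n j}
         then 1 - circulant_D (n j) (n j - k j) $$ (i - s, c - s) else 1)"
proof -
  let ?D = "\<lambda>i. circulant_D (n i) (n i - k i)"
  let ?As = "map ?D [1..<j]" and ?Cs = "map ?D [j + 1..<m + 1]"
  have "[1..<m + 1] = [1..<j] @ j # [j + 1..<m + 1]"
    using assms(2) upt_add_eq_append[of 1 j "m + 1 - j"] by (simp add: upt_conv_Cons)
  then have M: "M = complement_mat (diag_block_mat (?As @ ?D j # ?Cs))"
    using assms(1) by (simp add: circulant_block_diagonal_def)
  define s where "s = sum_list (map dim_row ?As)"
  have dim: "dim_row (circulant_D a b) = a" "dim_col (circulant_D a b) = a" for a b
    by (simp_all add: circulant_D_def)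
  have sq: "Ball (set ?As) square_mat" by (auto simp: dim)
  have "s = sum_list (map dim_col ?As)"
    unfolding s_def by (simp add: dim o_def)
  show thesis
  proof (rule that)
    show "s + n j \<le> dim_row M"
      by (simp add: M complement_mat_def dim_diag_block_mat s_def dim)
    show "s + n j \<le> dim_col M"
      using \<open>s = sum_list (map dim_col ?As)\<close>
      by (simp add: M complement_mat_def dim_diag_block_mat dim)
    fix i c
    assume "i < dim_row M" "c < dim_col M" "i \<in> {s..<s + n j} \<or> c \<in> {s..<s + n j}"
    then show "M $$ (i, c) = (if i \<in> {s..<s + n j} \<and> c \<in> {s..<s + n j}
         then 1 - ?D j $$ (i - s, c - s) else 1)"
      using diag_block_mat_entry[OF sq s_def, of i "?D j" ?Cs c]
      by (simp add: M complement_mat_def dim)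
  qed
qed

section \<open>Rectangles through a one of the block\<close>

theorem theorem4p6:
  fixes m j :: nat and k n :: "nat \<Rightarrow> nat" and M :: "real mat"
  assumes "m \<ge> 1"
    and "\<forall>i\<in>{1..m}. k i \<le> n i"
    and "M = complement_mat (circulant_block_diagonal m k n)"
    and "j \<in> {1..m}"
    and "k j > 0"
    and "n j = k j + gcd (n j) (k j)"
    and "gcd (n j) (k j) > 1"
  shows "binary_rank M \<ge> real_rank M + 1"
proof (rule ccontr)
  assume "\<not> ?thesis"
  moreover obtain P where P: "rectangle_partition M P" "card P = binary_rank M"
    using binary_rank_attained by blast
  ultimately have rank: "card P \<le> real_rank M" by simp
  define d where "d = gcd (n j) (k j)"
  obtain r where r: "k j = d * r"
    unfolding d_def using gcd_dvd2 by blast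
  then have nj: "n j = d * Suc r" using assms(6) by (simp add: d_def)
  have d: "1 < d" "0 < d" using assms(7) unfolding d_def by linarith+
  have "r \<ge> 1" using assms(5) r by (cases r) auto
  let ?C = "circulant_D (d * Suc r) d"
  obtain s where s: "s + d * Suc r \<le> dim_row M" "s + d * Suc r \<le> dim_col M"
    and entry: "\<And>i c. i < dim_row M \<Longrightarrow> c < dim_col M \<Longrightarrow>
      i \<in> {s..<s + d * Suc r} \<or> c \<in> {s..<s + d * Suc r} \<Longrightarrow>
      M $$ (i, c) = (if i \<in> {s..<s + d * Suc r} \<and> c \<in> {s..<s + d * Suc r}
        then 1 - ?C $$ (i - s, c - s) else 1)"
    using complement_circulant_block_diagonal_entry[OF assms(3,4)]
    by (metis nj r add_diff_cancel_left' mult_Suc_right add.commute)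
  \<comment> \<open>For fixed \<open>e < d\<close>, the indices \<open>x e q\<close> run through one
    residue class of the block, for rows and for columns alike.\<close>
  define x where "x e q = s + (e + q * d)" for e q
  have x: "x e q \<in> {s..<s + d * Suc r}" if "e < d" "q \<le> r" for e q
  proof -
    have "e + q * d < Suc q * d" using that by simp
    also have "\<dots> \<le> Suc r * d" using that by (intro mult_le_mono1) simp
    finally show ?thesis by (simp add: x_def mult.commute)
  qed
  then have x_less: "x e q < dim_row M" "x e q < dim_col M" if "e < d" "q \<le> r" for e q
    using that s by fastforce+
  have one_iff: "M $$ (x i q, x c p) = 1 \<longleftrightarrow> (if c < i then p = q else Suc p mod Suc r = q)"
    if "i < d" "c < d" "q \<le> r" "p \<le> r" for i c q p
  proof -
    have "M $$ (x i q, x c p) = 1 - ?C $$ (x i q - s, x c p - s)"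
      using that x x_less by (subst entry) auto
    then show ?thesis
      using circulant_D_entry[OF that] by (simp add: x_def)
  qed
  \<comment> \<open>The value does not depend on \<open>e\<close>; this is the linear relation
    between the row classes.\<close>
  have row_sum: "(\<Sum>q\<le>r. M $$ (x e q, c)) = (if c \<in> {s..<s + d * Suc r} then 1 else Suc r)"
    if "e < d" "c < dim_col M" for e c
  proof -
    have "(\<Sum>q\<le>r. M $$ (x e q, c)) =
        (\<Sum>q\<le>r. if c \<in> {s..<s + d * Suc r} then 1 - ?C $$ (e + q * d, c - s) else 1)"
      using that x x_less by (intro sum.cong) (auto simp: entry x_def)
    also have "\<dots> = (if c \<in> {s..<s + d * Suc r} then 1 else Suc r)"
      using sum_circulant_D_rows[OF that(1), of "c - s" r] by (auto simp: sum_subtractf)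
    finally show ?thesis .
  qed
  have col_sum: "(\<Sum>q\<le>r. M $$ (i, x e q)) = (if i \<in> {s..<s + d * Suc r} then 1 else Suc r)"
    if "e < d" "i < dim_row M" for e i
  proof -
    have "(\<Sum>q\<le>r. M $$ (i, x e q)) =
        (\<Sum>q\<le>r. if i \<in> {s..<s + d * Suc r} then 1 - ?C $$ (i - s, e + q * d) else 1)"
      using that x x_less by (intro sum.cong) (auto simp: entry x_def)
    also have "\<dots> = (if i \<in> {s..<s + d * Suc r} then 1 else Suc r)"
      using sum_circulant_D_cols[OF that(1), of "i - s" r] by (auto simp: sum_subtractf)
    finally show ?thesis .
  qed
  note bin = complement_circulant_block_diagonal_binary[OF assms(3)]
  \<comment> \<open>In the first row of the block, the one of column class 0 sits in the last group
    by wrap-around.\<close>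
  have "M $$ (x 0 0, x 0 r) = 1" using one_iff[of 0 0 0 r] d by simp
  then have "(x 0 0, x 0 r) \<in> ones M" using x_less d by (simp add: ones_def)
  then obtain R where R: "R \<in> P" "(x 0 0, x 0 r) \<in> R"
    using P(1) by (auto simp: rectangle_partition_def partition_on_def)
  then have rect: "comb_rectangle M R" using P(1) by (simp add: rectangle_partition_def)
  have in_R: "x 0 0 \<in> fst ` R" "x 0 r \<in> snd ` R" using R(2) rectangle_mem_iff[OF rect] by blast+
  \<comment> \<open>Class 1 exists because \<open>d > 1\<close>. As \<open>R\<close> meets row class
    0, it must also meet row class 1.\<close>
  have "(\<Sum>q\<le>r. of_bool (x 0 q \<in> fst ` R)) = (\<Sum>q\<le>r. of_bool (x 1 q \<in> fst ` R) :: real)"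
    by (rule rank_partition_row_relation[OF P(1) bin rank])
      (use x_less d R(1) in \<open>auto simp: row_sum\<close>)
  moreover have "(\<Sum>q\<le>r. of_bool (x 0 q \<in> fst ` R) :: real) > 0"
    by (rule sum_pos2[of _ 0]) (use in_R in auto)
  ultimately have "(\<Sum>q\<le>r. of_bool (x 1 q \<in> fst ` R) :: real) \<noteq> 0" by linarith
  then obtain q where q: "q \<le> r" "x 1 q \<in> fst ` R"
    by (elim sum.not_neutral_contains_not_neutral) auto
  have "(\<Sum>q\<le>r. of_bool (x 0 q \<in> snd ` R)) = (\<Sum>q\<le>r. of_bool (x 1 q \<in> snd ` R) :: real)"
    by (rule rank_partition_col_relation[OF P(1) bin rank])
      (use x_less d R(1) in \<open>auto simp: col_sum\<close>)
  moreover have "(\<Sum>q\<le>r. of_bool (x 0 q \<in> snd ` R) :: real) > 0"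
    by (rule sum_pos2[of _ r]) (use in_R in auto)
  ultimately have "(\<Sum>q\<le>r. of_bool (x 1 q \<in> snd ` R) :: real) \<noteq> 0" by linarith
  then obtain p where p: "p \<le> r" "x 1 p \<in> snd ` R"
    by (elim sum.not_neutral_contains_not_neutral) auto
  have one: "M $$ (i, c) = 1" if "i \<in> fst ` R" "c \<in> snd ` R" for i c
    using rect that by (auto simp: comb_rectangle_def)
  \<comment> \<open>The other three corners of the rectangle must be ones too. They force
    \<open>q = r\<close> and \<open>q = 0\<close>, against \<open>r \<ge> 1\<close>.\<close>
  have "Suc p mod Suc r = 0"
    using one_iff[of 0 1 0 p] one[OF in_R(1) p(2)] d p by simp
  moreover have "r = q"
    using one_iff[of 1 0 q r] one[OF q(2) in_R(2)] d q by simp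
  moreover have "Suc p mod Suc r = q"
    using one_iff[of 1 1 q p] one[OF q(2) p(2)] d q p by simp
  ultimately show False using \<open>r \<ge> 1\<close> by simp
qed

end
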